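(* Let $\lambda\ge 0$, $\varepsilon>0$, $\sigma=\sigma(\lambda,\varepsilon)$, and $0\le r\le t$. The distribution of the first branching time $\tau_1=\inf\{s>0: n(s)=2\}$ under $\widehat P_{\lambda,t}$ is given by $$\widehat P_{\lambda,t}\left(\tau_1\le t-r\right)=\sigma\,\frac{e^{-r}-e^{-t}}{1-\sigma\,(1-e^{-r})}.$$
   Context: Binary branching Brownian motion (BBM) on $\mathbb{R}$: start with a single particle at $0$ at time $0$. Each particle moves as a standard Brownian motion and lives for an independent standard (rate $1$) exponential time, at the end of which it is replaced by exactly two particles that continue from its position independently according to the same rules. $\mathbb{P}$, $\mathbb{E}$ denote the law and expectation of BBM and $n(t)$ is the number of particles at time $t$. Set $\sigma(\lambda,\varepsilon)=\operatorname{sech}(\varepsilon\sqrt{2\lambda})$, and $v_\sigma(t)=\mathbb{E}[\sigma^{n(t)-1}]$. The simplified model with self-repulsion is the tilted law $\widehat P_{\lambda,t}(A)=\mathbb{E}[\mathbf 1_A\,\sigma(\lambda,\varepsilon)^{n(t)-1}]/v_{\sigma(\lambda,\varepsilon)}(t)$. *)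

theory Defs
  imports "HOL-Probability.Probability"
begin

locale standard_brownian_motion = prob_space M for M :: "'w measure" +
  fixes W :: "real \<Rightarrow> 'w \<Rightarrow> real"
  assumes measurable_at: "0 \<le> s \<Longrightarrow> W s \<in> borel_measurable M"
    and starts_at_0: "w \<in> space M \<Longrightarrow> W 0 w = 0"
    and continuous_paths: "w \<in> space M \<Longrightarrow> continuous_on {0..} (\<lambda>s. W s w)"
    and independent_increments:
      "\<lbrakk>0 \<le> p (0::nat); \<And>i. i < k \<Longrightarrow> p i \<le> p (Suc i)\<rbrakk> \<Longrightarrow>
        indep_vars (\<lambda>_. borel) (\<lambda>i w. W (p (Suc i)) w - W (p i) w) {..<k}"
    and normal_increments:
      "\<lbrakk>0 \<le> s; s < t\<rbrakk> \<Longrightarrow>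
        distributed M lborel (\<lambda>w. W t w - W s w) (normal_density 0 (sqrt (t - s)))"

text \<open>
  Particles carry binary Ulam--Harris labels: the initial particle is the empty list and the two
  children of \<open>u\<close> are \<open>u @ [False]\<close> and \<open>u @ [True]\<close>, so that \<open>take k u\<close> for \<open>k < length u\<close> are the
  strict ancestors of \<open>u\<close>. The particle \<open>u\<close> has lifetime \<open>L u\<close>, and \<open>B u s\<close> is its displacement
  from its place of birth when it has age \<open>s\<close>.
\<close>

definition birth_time :: "(bool list \<Rightarrow> 'w \<Rightarrow> real) \<Rightarrow> bool list \<Rightarrow> 'w \<Rightarrow> real" where
  "birth_time L u w = (\<Sum>k<length u. L (take k u) w)"

definition alive :: "(bool list \<Rightarrow> 'w \<Rightarrow> real) \<Rightarrow> bool list \<Rightarrow> real \<Rightarrow> 'w \<Rightarrow> bool" where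
  "alive L u t w \<longleftrightarrow> birth_time L u w \<le> t \<and> t < birth_time L u w + L u w"

definition position ::
  "(bool list \<Rightarrow> 'w \<Rightarrow> real) \<Rightarrow> (bool list \<Rightarrow> real \<Rightarrow> 'w \<Rightarrow> real) \<Rightarrow> bool list \<Rightarrow> real \<Rightarrow> 'w \<Rightarrow> real"
  where
  "position L B u t w =
    (\<Sum>k<length u. B (take k u) (L (take k u) w) w) + B u (t - birth_time L u w) w"

definition particles ::
  "(bool list \<Rightarrow> 'w \<Rightarrow> real) \<Rightarrow> (bool list \<Rightarrow> real \<Rightarrow> 'w \<Rightarrow> real) \<Rightarrow> real \<Rightarrow> 'w \<Rightarrow> (bool list \<times> real) set"
  where
  "particles L B t w = {(u, x). alive L u t w \<and> x = position L B u t w}"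

text \<open>
  All lifetimes and all displacement processes are jointly independent. Lifetimes are
  positive everywhere and not just almost surely, so that the first branching time below is the
  lifetime of the initial particle everywhere; otherwise its measurability could fail on a null set
  of a space that is not assumed to be complete.
\<close>

locale binary_BBM = prob_space M for M :: "'w measure" +
  fixes L :: "bool list \<Rightarrow> 'w \<Rightarrow> real"
    and B :: "bool list \<Rightarrow> real \<Rightarrow> 'w \<Rightarrow> real"
  assumes lifetime_exponential: "distributed M lborel (L u) (exponential_density 1)"
    and lifetime_pos: "w \<in> space M \<Longrightarrow> 0 < L u w"
    and displacement_brownian: "standard_brownian_motion M (B u)"
    and independent:
      "indep_sets
        (case_sum
          (\<lambda>u. sets (vimage_algebra (space M) (L u) borel))
          (\<lambda>u. sets (vimage_algebra (space M) (\<lambda>w. \<lambda>s\<in>{0..}. B u s w) (PiM {0..} (\<lambda>_. borel)))))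
        UNIV"

text \<open>
  The set of particles is almost surely finite and nonempty, so neither the value 0 of the
  cardinality of infinite sets nor the truncated subtraction in \<open>n(t) - 1\<close> affects expectations.
\<close>

definition num_particles ::
  "(bool list \<Rightarrow> 'w \<Rightarrow> real) \<Rightarrow> (bool list \<Rightarrow> real \<Rightarrow> 'w \<Rightarrow> real) \<Rightarrow> real \<Rightarrow> 'w \<Rightarrow> nat" where
  "num_particles L B t w = card (particles L B t w)"

text \<open>In a \<open>binary_BBM\<close>, the set below is nonempty since all lifetimes are positive.\<close>

definition first_branching_time ::
  "(bool list \<Rightarrow> 'w \<Rightarrow> real) \<Rightarrow> (bool list \<Rightarrow> real \<Rightarrow> 'w \<Rightarrow> real) \<Rightarrow> 'w \<Rightarrow> real" where
  "first_branching_time L B w = Inf {s. 0 < s \<and> num_particles L B s w = 2}"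

definition sech :: "real \<Rightarrow> real" where
  "sech x = 1 / cosh x"

definition repulsion_sigma :: "real \<Rightarrow> real \<Rightarrow> real" where
  "repulsion_sigma lam \<epsilon> = sech (\<epsilon> * sqrt (2 * lam))"

definition v_fun ::
  "'w measure \<Rightarrow> (bool list \<Rightarrow> 'w \<Rightarrow> real) \<Rightarrow> (bool list \<Rightarrow> real \<Rightarrow> 'w \<Rightarrow> real) \<Rightarrow> real \<Rightarrow> real \<Rightarrow> real"
  where
  "v_fun M L B \<sigma> t = (\<integral>w. \<sigma> ^ (num_particles L B t w - 1) \<partial>M)"

definition tilted_law ::
  "'w measure \<Rightarrow> (bool list \<Rightarrow> 'w \<Rightarrow> real) \<Rightarrow> (bool list \<Rightarrow> real \<Rightarrow> 'w \<Rightarrow> real) \<Rightarrow>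
    real \<Rightarrow> real \<Rightarrow> real \<Rightarrow> 'w set \<Rightarrow> real"
  where
  "tilted_law M L B lam \<epsilon> t A =
    (\<integral>w. indicator A w * repulsion_sigma lam \<epsilon> ^ (num_particles L B t w - 1) \<partial>M) /
    v_fun M L B (repulsion_sigma lam \<epsilon>) t"

end

theory Submission
  imports Defs
begin

text \<open>
  The number of particles depends on the lifetimes alone, and the first branching time is the
  lifetime \<open>x\<close> of the initial particle. If \<open>x > t\<close>, then \<open>n(t) - 1 = 0\<close>. If \<open>x \<le> t\<close>, then the two
  children start independent copies of the process, and \<open>n(t) - 1\<close> is \<open>1\<close> plus the values of
  \<open>n - 1\<close> for the two copies at time \<open>t - x\<close>. Hence \<open>v(t) = E[\<sigma>^(n(t) - 1)]\<close> solves
  \<open>v(t) = exp (- t) + (\<integral> x = 0..t. exp (- x) * \<sigma> * v(t - x)^2)\<close>, that is, \<open>v' = \<sigma> v^2 - v\<close> with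
  \<open>v(0) = 1\<close>, which gives \<open>v(t) = exp (- t) / (1 - \<sigma> (1 - exp (- t)))\<close>; this function is
  \<open>yule_mean\<close> below. Restricting the same integral to \<open>x \<le> b\<close> gives the part of the expectation on the
  event that the first branching occurs before \<open>b\<close>. It equals \<open>v(t) - exp (- b) v(t - b)\<close>, since
  \<open>- exp (- x) v(t - x)\<close> is an antiderivative of the integrand (\<open>integral_yule_mean_square\<close>). The
  theorem is the case \<open>b = t - r\<close>, divided by \<open>v(t)\<close>.
  
  Two points need care: that \<open>v\<close> is the solution of the integral equation, and that the tree is
  almost surely finite at time \<open>t\<close>, without which \<open>n(t)\<close> is not the sum over the two subtrees.
  One estimate settles both. Let \<open>v_d(t)\<close> be the expectation of \<open>\<sigma>^(n(t) - 1)\<close> on the event that all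
  particles born by time \<open>t\<close> have generation less than \<open>d\<close>. On this event everything is finite, so
  that \<open>v_d\<close> are the Picard iterates of the integral equation, started at \<open>v_0 = 0\<close>
  (\<open>integral_confined_weight_Suc\<close>). The map is Lipschitz with constant \<open>2\<close> on functions
  with values in \<open>[0, 1]\<close>, so that \<open>\<bar>v_d(t) - v(t)\<bar> \<le> (2 t)^d / d!\<close> (\<open>mean_weight_near_yule_mean\<close>). For
  \<open>\<sigma> = 1\<close> the solution is the constant \<open>1\<close> and \<open>v_d(t)\<close> is the probability of the event itself, so
  the same bound controls the probability that generation \<open>d\<close> has been reached by time \<open>t\<close>.
  Letting \<open>d\<close> tend to infinity yields \<open>expectation_lifetime_weight\<close>.
\<close>

section \<open>Splitting an i.i.d. family over the binary tree at its root\<close>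

definition graft :: "'a \<Rightarrow> (bool list \<Rightarrow> 'a) \<Rightarrow> (bool list \<Rightarrow> 'a) \<Rightarrow> bool list \<Rightarrow> 'a" where
  "graft x f g u = (case u of [] \<Rightarrow> x | b # v \<Rightarrow> (if b then g else f) v)"

lemma graft_simps [simp]:
  "graft x f g [] = x"
  "(\<lambda>u. graft x f g (False # u)) = f"
  "(\<lambda>u. graft x f g (True # u)) = g"
  by (simp_all add: graft_def)

lemma measurable_graft:
  "(\<lambda>(x, f, g). graft x f g) \<in>
    N \<Otimes>\<^sub>M (PiM UNIV (\<lambda>_. N) \<Otimes>\<^sub>M PiM UNIV (\<lambda>_. N)) \<rightarrow>\<^sub>M PiM UNIV (\<lambda>_. N)"
proof (rule measurable_PiM_single')
  fix u :: "bool list"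
  show "(\<lambda>p. (case p of (x, f, g) \<Rightarrow> graft x f g) u) \<in>
    N \<Otimes>\<^sub>M (PiM UNIV (\<lambda>_. N) \<Otimes>\<^sub>M PiM UNIV (\<lambda>_. N)) \<rightarrow>\<^sub>M N"
  proof (cases u)
    case (Cons b v)
    then show ?thesis
      by (cases b) (simp_all add: graft_def case_prod_beta)
  qed (simp add: graft_def case_prod_beta)
qed (auto simp: space_pair_measure space_PiM PiE_iff graft_def split: list.split)

text \<open>
  The branching property: an i.i.d. family indexed by the binary tree consists of its value at the
  root and two i.i.d. families on the two subtrees, all independent. Both measures are compared on
  cylinder sets, where a finite set of labels splits into the root and the labels below each of
  the two children.
\<close>

lemma distr_graft:
  assumes "prob_space N"
  shows "distr (N \<Otimes>\<^sub>M (PiM UNIV (\<lambda>_. N) \<Otimes>\<^sub>M PiM UNIV (\<lambda>_. N))) (PiM UNIV (\<lambda>_. N))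
    (\<lambda>(x, f, g). graft x f g) = PiM UNIV (\<lambda>_::bool list. N)"
    (is "distr ?Q ?P ?m = _")
proof -
  interpret N: prob_space N by fact
  interpret P: product_prob_space "\<lambda>_::bool list. N" UNIV
    by unfold_locales
  interpret PP': prob_space "?P \<Otimes>\<^sub>M ?P"
    by (intro prob_space_pair P.prob_space_axioms)
  show ?thesis
  proof (rule P.PiM_eq)
    fix J :: "bool list set" and F
    assume J: "finite J" and F: "\<And>j. j \<in> J \<Longrightarrow> F j \<in> sets N"
    define A where "A = (if [] \<in> J then F [] else space N)"
    define K where "K b = Cons b -` J" for b
    define E where "E b = prod_emb UNIV (\<lambda>_. N) (K b) (\<Pi>\<^sub>E v\<in>K b. F (b # v))" for b
    have fin: "finite (K b)" for b
      unfolding K_def using J by (intro finite_vimageI) auto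
    have FK: "F (b # v) \<in> sets N" if "v \<in> K b" for b v
      using that F by (auto simp: K_def)
    have A: "A \<in> sets N"
      using F by (auto simp: A_def)
    have E: "E b \<in> sets ?P" for b
      unfolding E_def by (intro sets_PiM_I fin) (use FK in auto)
    have pre: "?m -` prod_emb UNIV (\<lambda>_. N) J (\<Pi>\<^sub>E j\<in>J. F j) \<inter> space ?Q = A \<times> E False \<times> E True"
    proof (intro set_eqI)
      fix p :: "'a \<times> (bool list \<Rightarrow> 'a) \<times> (bool list \<Rightarrow> 'a)"
      obtain x f g where p: "p = (x, f, g)"
        by (metis prod_cases3)
      have "(\<forall>j\<in>J. graft x f g j \<in> F j) \<longleftrightarrow>
          ([] \<in> J \<longrightarrow> x \<in> F []) \<and> (\<forall>v\<in>K False. f v \<in> F (False # v)) \<and> (\<forall>v\<in>K True. g v \<in> F (True # v))"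
        (is "?L \<longleftrightarrow> ?R")
      proof
        assume ?L
        then show ?R
          by (force simp: K_def graft_def)
      next
        assume ?R
        show ?L
        proof
          fix j assume "j \<in> J"
          with \<open>?R\<close> show "graft x f g j \<in> F j"
            by (cases j) (auto simp: K_def graft_def)
        qed
      qed
      moreover have "x \<in> space N" if "x \<in> F []" "[] \<in> J"
        using F[of "[]"] sets.sets_into_space that by blast
      moreover have "range (graft x f g) \<subseteq> space N"
        if "x \<in> space N" "range f \<subseteq> space N" "range g \<subseteq> space N"
        using that by (force simp: graft_def split: list.split)
      ultimately show "p \<in> ?m -` prod_emb UNIV (\<lambda>_. N) J (\<Pi>\<^sub>E j\<in>J. F j) \<inter> space ?Q \<longleftrightarrow>
          p \<in> A \<times> E False \<times> E True"
        unfolding p A_def E_def prod_emb_def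
        by (auto simp: space_pair_measure space_PiM PiE_iff image_subset_iff)
    qed
    have "emeasure (distr ?Q ?P ?m) (prod_emb UNIV (\<lambda>_. N) J (\<Pi>\<^sub>E j\<in>J. F j)) =
        emeasure ?Q (A \<times> E False \<times> E True)"
      by (subst emeasure_distr) (use J F measurable_graft pre in \<open>auto intro!: sets_PiM_I\<close>)
    also have "\<dots> = emeasure N A * (emeasure ?P (E False) * emeasure ?P (E True))"
      using A E by (simp add: PP'.emeasure_pair_measure_Times P.emeasure_pair_measure_Times)
    also have "\<dots> = emeasure N A * ((\<Prod>v\<in>K False. emeasure N (F (False # v))) *
        (\<Prod>v\<in>K True. emeasure N (F (True # v))))"
      unfolding E_def using fin FK by (simp add: P.emeasure_PiM_emb)
    also have "emeasure N A = (\<Prod>j\<in>J \<inter> {[]}. emeasure N (F j))"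
      by (auto simp: A_def N.emeasure_space_1)
    also have "\<dots> * ((\<Prod>v\<in>K False. emeasure N (F (False # v))) *
        (\<Prod>v\<in>K True. emeasure N (F (True # v)))) =
      (\<Prod>j\<in>J \<inter> {[]}. emeasure N (F j)) *
        ((\<Prod>j\<in>Cons False ` K False. emeasure N (F j)) * (\<Prod>j\<in>Cons True ` K True. emeasure N (F j)))"
      by (subst (1 2) prod.reindex) (auto simp: inj_on_def)
    also have "\<dots> = (\<Prod>j\<in>(J \<inter> {[]}) \<union> (Cons False ` K False \<union> Cons True ` K True). emeasure N (F j))"
      using J fin by (subst prod.union_disjoint, simp, simp, force, subst prod.union_disjoint) auto
    also have "(J \<inter> {[]}) \<union> (Cons False ` K False \<union> Cons True ` K True) = J"
    proof (intro set_eqI)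
      fix j show "j \<in> (J \<inter> {[]}) \<union> (Cons False ` K False \<union> Cons True ` K True) \<longleftrightarrow> j \<in> J"
        by (cases j; cases "hd j") (auto simp: K_def)
    qed
    finally show "emeasure (distr ?Q ?P ?m) (prod_emb UNIV (\<lambda>_. N) J (\<Pi>\<^sub>E j\<in>J. F j)) =
        (\<Prod>j\<in>J. emeasure N (F j))" .
  qed simp
qed

section \<open>Trees confined to finitely many generations\<close>

abbreviation exp_law :: "real measure" where
  "exp_law \<equiv> density lborel (exponential_density 1)"

abbreviation tree_law :: "(bool list \<Rightarrow> real) measure" where
  "tree_law \<equiv> PiM UNIV (\<lambda>_. exp_law)"

text \<open>
  For a family \<open>l\<close> of lifetimes, this is \<open>\<sigma>^(n(t) - 1)\<close> if every particle born by time \<open>t\<close> has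
  generation less than \<open>d\<close>, and \<open>0\<close> otherwise. For \<open>\<sigma> = 1\<close> it is the indicator of that event. The
  recursion follows the first branching, which makes independence and measurability immediate
  and avoids cardinalities; \<open>confined_weight_cases\<close> below relates it to the particle count.
\<close>

primrec confined_weight :: "real \<Rightarrow> nat \<Rightarrow> (bool list \<Rightarrow> real) \<Rightarrow> real \<Rightarrow> real" where
  "confined_weight \<sigma> 0 l t = 0"
| "confined_weight \<sigma> (Suc d) l t =
    (if t < l [] then 1
     else \<sigma> * confined_weight \<sigma> d (\<lambda>u. l (False # u)) (t - l []) *
       confined_weight \<sigma> d (\<lambda>u. l (True # u)) (t - l []))"

lemma prob_space_exp_law: "prob_space exp_law"
  by (rule prob_space_exponential_density) simp

lemma prob_space_tree_law: "prob_space tree_law"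
  by (intro prob_space_PiM prob_space_exp_law)

lemma confined_weight_bounds:
  assumes "0 \<le> \<sigma>" "\<sigma> \<le> 1"
  shows "0 \<le> confined_weight \<sigma> d l t" "confined_weight \<sigma> d l t \<le> 1"
proof (induction d arbitrary: l t)
  case (Suc d)
  {
    case 1
    then show ?case
      using assms Suc by simp
  next
    case 2
    then show ?case
      using assms Suc by (simp add: mult_le_one)
  }
qed simp_all

lemma measurable_confined_weight [measurable]:
  "(\<lambda>(l, t). confined_weight \<sigma> d l t) \<in> borel_measurable (tree_law \<Otimes>\<^sub>M borel)"
proof (induction d)
  case (Suc d)
  have [measurable]: "(\<lambda>p. fst p []) \<in> tree_law \<Otimes>\<^sub>M (borel :: real measure) \<rightarrow>\<^sub>M borel"
    using measurable_compose[OF measurable_fst measurable_component_singleton[of "[]" UNIV "\<lambda>_. exp_law"]]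
    by simp
  have sub [measurable]: "(\<lambda>(l, t). (\<lambda>u. l (b # u), t - l [])) \<in>
      tree_law \<Otimes>\<^sub>M borel \<rightarrow>\<^sub>M tree_law \<Otimes>\<^sub>M borel" for b :: bool
  proof -
    have [measurable]: "(\<lambda>p. \<lambda>u. fst p (b # u)) \<in> tree_law \<Otimes>\<^sub>M (borel :: real measure) \<rightarrow>\<^sub>M tree_law"
      by (rule measurable_PiM_single') (auto simp: space_PiM)
    show ?thesis
      unfolding case_prod_beta by measurable
  qed
  have [measurable]: "(\<lambda>(l, t). confined_weight \<sigma> d (\<lambda>u. l (b # u)) (t - l [])) \<in>
      borel_measurable (tree_law \<Otimes>\<^sub>M borel)" for b
    using measurable_compose[OF sub Suc, of b] by (simp add: case_prod_beta)
  then have [measurable]: "(\<lambda>p. confined_weight \<sigma> d (\<lambda>u. fst p (b # u)) (snd p - fst p [])) \<in>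
      borel_measurable (tree_law \<Otimes>\<^sub>M borel)" for b
    by (simp add: case_prod_beta)
  show ?case
    unfolding confined_weight.simps case_prod_beta by measurable
qed simp

definition mean_weight :: "real \<Rightarrow> nat \<Rightarrow> real \<Rightarrow> real" where
  "mean_weight \<sigma> d t = (\<integral>l. confined_weight \<sigma> d l t \<partial>tree_law)"

lemma measurable_confined_weight_at [measurable]:
  "(\<lambda>l. confined_weight \<sigma> d l t) \<in> borel_measurable tree_law"
  using measurable_Pair2[OF measurable_confined_weight] by simp

lemma measurable_mean_weight [measurable]: "mean_weight \<sigma> d \<in> borel_measurable borel"
proof -
  interpret sigma_finite_measure tree_law
    using prob_space_tree_law by (simp add: prob_space_imp_sigma_finite)
  have "(\<lambda>(t, l). confined_weight \<sigma> d l t) \<in> borel_measurable (borel \<Otimes>\<^sub>M tree_law)"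
    using measurable_pair_swap[OF measurable_confined_weight] by (simp add: case_prod_beta)
  from borel_measurable_lebesgue_integral[OF this] show ?thesis
    unfolding mean_weight_def[abs_def] .
qed

lemma integrable_confined_weight:
  assumes "0 \<le> \<sigma>" "\<sigma> \<le> 1"
  shows "integrable tree_law (\<lambda>l. confined_weight \<sigma> d l t)"
proof -
  interpret prob_space tree_law by (rule prob_space_tree_law)
  show ?thesis
    by (rule integrable_const_bound[where B = 1]) (use confined_weight_bounds[OF assms] in auto)
qed

lemma mean_weight_bounds:
  assumes "0 \<le> \<sigma>" "\<sigma> \<le> 1"
  shows "0 \<le> mean_weight \<sigma> d t" "mean_weight \<sigma> d t \<le> 1"
proof -
  interpret prob_space tree_law by (rule prob_space_tree_law)
  show "0 \<le> mean_weight \<sigma> d t"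
    unfolding mean_weight_def by (intro integral_nonneg_AE) (use confined_weight_bounds[OF assms] in auto)
  show "mean_weight \<sigma> d t \<le> 1"
    unfolding mean_weight_def
    by (rule integral_le_const) (use confined_weight_bounds[OF assms] integrable_confined_weight[OF assms] in auto)
qed

text \<open>
  The conditional mean of the weight at time \<open>t\<close>, given that the initial particle has lifetime \<open>x\<close>,
  when each subtree contributes the mean \<open>f (t - x)\<close>.
\<close>

definition renewal :: "real \<Rightarrow> (real \<Rightarrow> real) \<Rightarrow> real \<Rightarrow> real \<Rightarrow> real" where
  "renewal \<sigma> f t x = (if t < x then 1 else \<sigma> * (f (t - x))\<^sup>2)"

text \<open>
  By \<open>distr_graft\<close> the expectation becomes an iterated integral over the root lifetime \<open>x\<close> and
  the two subtrees; for fixed \<open>x\<close> the integrals over the subtrees factorise, and each factor is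
  \<open>mean_weight \<sigma> d (t - x)\<close>. The factor \<open>\<phi>\<close> allows later to restrict to an event that
  depends on the root lifetime.
\<close>

lemma integral_confined_weight_Suc:
  assumes \<sigma>: "0 \<le> \<sigma>" "\<sigma> \<le> 1"
    and [measurable]: "\<phi> \<in> borel_measurable borel" and \<phi>: "\<And>x. \<bar>\<phi> x\<bar> \<le> 1"
  shows "(\<integral>l. \<phi> (l []) * confined_weight \<sigma> (Suc d) l t \<partial>tree_law) =
    (\<integral>x. \<phi> x * renewal \<sigma> (mean_weight \<sigma> d) t x \<partial>exp_law)"
proof -
  let ?W = "confined_weight \<sigma>"
  let ?Q = "exp_law \<Otimes>\<^sub>M (tree_law \<Otimes>\<^sub>M tree_law)"
  define F where "F = (\<lambda>l. \<phi> (l []) * ?W (Suc d) l t)"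
  interpret E: prob_space exp_law by (rule prob_space_exp_law)
  interpret T: prob_space tree_law by (rule prob_space_tree_law)
  interpret TT: prob_space "tree_law \<Otimes>\<^sub>M tree_law"
    by (intro prob_space_pair T.prob_space_axioms)
  interpret Q: prob_space ?Q
    by (intro prob_space_pair E.prob_space_axioms TT.prob_space_axioms)
  interpret PTT: pair_sigma_finite tree_law tree_law by unfold_locales
  interpret PQ: pair_sigma_finite exp_law "tree_law \<Otimes>\<^sub>M tree_law" by unfold_locales
  have root [measurable]: "(\<lambda>l. l []) \<in> tree_law \<rightarrow>\<^sub>M borel"
    using measurable_component_singleton[of "[]" UNIV "\<lambda>_. exp_law"] by simp
  have F [measurable]: "F \<in> borel_measurable tree_law"
    unfolding F_def by measurable
  have Fb: "\<bar>F l\<bar> \<le> 1" for l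
    unfolding F_def abs_mult using \<phi> confined_weight_bounds[OF \<sigma>, of "Suc d" l t]
    by (intro mult_le_one) auto
  have Fg: "F (graft x f g) =
      \<phi> x * (if t < x then 1 else \<sigma> * (?W d f (t - x) * ?W d g (t - x)))" for x f g
    by (simp add: F_def mult.assoc)
  have meas [measurable]: "(\<lambda>(x, f, g). F (graft x f g)) \<in> borel_measurable ?Q"
    using measurable_compose[OF measurable_graft F] by (simp add: case_prod_beta)
  have "integral\<^sup>L tree_law F =
      integral\<^sup>L (distr ?Q tree_law (\<lambda>(x, f, g). graft x f g)) F"
    by (simp only: distr_graft[OF prob_space_exp_law])
  also have "\<dots> = (\<integral>p. (case p of (x, f, g) \<Rightarrow> F (graft x f g)) \<partial>?Q)"
    by (subst integral_distr[OF measurable_graft F], rule Bochner_Integration.integral_cong) auto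
  also have "\<dots> = (\<integral>x. (\<integral>p. (case p of (f, g) \<Rightarrow> F (graft x f g)) \<partial>(tree_law \<Otimes>\<^sub>M tree_law)) \<partial>exp_law)"
    by (subst PQ.integral_fst'[symmetric])
      (auto intro!: Q.integrable_const_bound[where B = 1] Fb)
  also have "\<dots> = (\<integral>x. \<phi> x * renewal \<sigma> (mean_weight \<sigma> d) t x \<partial>exp_law)"
  proof (rule Bochner_Integration.integral_cong[OF refl])
    fix x :: real
    have m: "(\<lambda>(f, g). F (graft x f g)) \<in> borel_measurable (tree_law \<Otimes>\<^sub>M tree_law)"
      unfolding Fg by measurable
    have "(\<integral>p. (case p of (f, g) \<Rightarrow> F (graft x f g)) \<partial>(tree_law \<Otimes>\<^sub>M tree_law)) =
        (\<integral>f. \<integral>g. F (graft x f g) \<partial>tree_law \<partial>tree_law)"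
      by (subst PTT.integral_fst'[symmetric])
        (use m Fb in \<open>auto intro!: TT.integrable_const_bound[where B = 1]\<close>)
    also have "\<dots> = \<phi> x * renewal \<sigma> (mean_weight \<sigma> d) t x"
      unfolding Fg renewal_def mean_weight_def
      by (simp add: T.prob_space power2_eq_square)
    finally show "(\<integral>p. (case p of (f, g) \<Rightarrow> F (graft x f g)) \<partial>(tree_law \<Otimes>\<^sub>M tree_law)) =
        \<phi> x * renewal \<sigma> (mean_weight \<sigma> d) t x" .
  qed
  finally show ?thesis
    unfolding F_def .
qed

section \<open>The solution of the integral equation\<close>

definition yule_mean :: "real \<Rightarrow> real \<Rightarrow> real" where
  "yule_mean \<sigma> t = exp (- t) / (1 - \<sigma> * (1 - exp (- t)))"

lemma yule_mean_0 [simp]: "yule_mean \<sigma> 0 = 1"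
  by (simp add: yule_mean_def)

lemma yule_mean_denominator_bounds:
  fixes \<sigma> t :: real
  assumes "\<sigma> \<le> 1" "0 \<le> t"
  shows "exp (- t) \<le> 1 - \<sigma> * (1 - exp (- t))" "0 < 1 - \<sigma> * (1 - exp (- t))"
proof -
  show "exp (- t) \<le> 1 - \<sigma> * (1 - exp (- t))"
    using mult_right_mono[OF assms(1), of "1 - exp (- t)"] assms by simp
  then show "0 < 1 - \<sigma> * (1 - exp (- t))"
    using exp_gt_zero[of "- t"] by linarith
qed

lemma yule_mean_bounds:
  assumes "\<sigma> \<le> 1" "0 \<le> t"
  shows "0 < yule_mean \<sigma> t" "yule_mean \<sigma> t \<le> 1"
  using yule_mean_denominator_bounds[OF assms] by (simp_all add: yule_mean_def)

lemma measurable_yule_mean [measurable]: "yule_mean \<sigma> \<in> borel_measurable borel"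
  unfolding yule_mean_def[abs_def] by measurable

text \<open>
  The Riccati equation that results from differentiating the integral equation.
\<close>

lemma DERIV_yule_mean:
  assumes "\<sigma> \<le> 1" "0 \<le> t"
  shows "(yule_mean \<sigma> has_real_derivative \<sigma> * (yule_mean \<sigma> t)\<^sup>2 - yule_mean \<sigma> t) (at t)"
proof -
  define D where "D = 1 - \<sigma> * (1 - exp (- t))"
  have "D \<noteq> 0"
    using yule_mean_denominator_bounds[OF assms] by (simp add: D_def)
  have "(yule_mean \<sigma> has_real_derivative
      (- exp (- t) * D - exp (- t) * (- \<sigma> * exp (- t))) / (D * D)) (at t)"
    unfolding yule_mean_def[abs_def] D_def using \<open>D \<noteq> 0\<close>[unfolded D_def]
    by (auto intro!: derivative_eq_intros)
  also have "(- exp (- t) * D - exp (- t) * (- \<sigma> * exp (- t))) / (D * D) =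
      \<sigma> * (yule_mean \<sigma> t)\<^sup>2 - yule_mean \<sigma> t"
    using \<open>D \<noteq> 0\<close> unfolding yule_mean_def D_def[symmetric]
    by (simp add: field_simps power2_eq_square)
  finally show ?thesis .
qed

lemma integral_exp_law_atMost:
  assumes [measurable]: "h \<in> borel_measurable borel"
  shows "(\<integral>x. indicator {..b} x * h x \<partial>exp_law) =
    (\<integral>x. (exp (- x) * h x) * indicator {0..b} x \<partial>lborel)"
proof -
  have "(\<integral>x. indicator {..b} x * h x \<partial>exp_law) =
      (\<integral>x. exponential_density 1 x *\<^sub>R (indicator {..b} x * h x) \<partial>lborel)"
    by (rule integral_density) (auto simp: exponential_density_def)
  also have "\<dots> = (\<integral>x. (exp (- x) * h x) * indicator {0..b} x \<partial>lborel)"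
    by (rule Bochner_Integration.integral_cong) (auto simp: exponential_density_def split: split_indicator)
  finally show ?thesis .
qed

lemma integral_exp_law_FTC:
  assumes "0 \<le> b" and [measurable]: "h \<in> borel_measurable borel"
    and "\<And>x. 0 \<le> x \<Longrightarrow> x \<le> b \<Longrightarrow> (H has_real_derivative exp (- x) * h x) (at x)"
    and "\<And>x. 0 \<le> x \<Longrightarrow> x \<le> b \<Longrightarrow> isCont h x"
  shows "(\<integral>x. indicator {..b} x * h x \<partial>exp_law) = H b - H 0"
  unfolding integral_exp_law_atMost[OF assms(2)]
  by (rule integral_FTC_Icc_real) (use assms in \<open>auto intro!: continuous_intros\<close>)

text \<open>
  The Riccati equation makes \<open>- exp (- x) * yule_mean \<sigma> (t - x)\<close> an antiderivative of
  \<open>exp (- x) * \<sigma> * (yule_mean \<sigma> (t - x))\<^sup>2\<close>: the linear term cancels against the derivative of the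
  exponential factor.
\<close>

lemma integral_yule_mean_square:
  assumes "\<sigma> \<le> 1" "0 \<le> b" "b \<le> t"
  shows "(\<integral>x. indicator {..b} x * (\<sigma> * (yule_mean \<sigma> (t - x))\<^sup>2) \<partial>exp_law) =
    yule_mean \<sigma> t - exp (- b) * yule_mean \<sigma> (t - b)"
proof -
  have D: "((\<lambda>x. yule_mean \<sigma> (t - x)) has_real_derivative
      - (\<sigma> * (yule_mean \<sigma> (t - x))\<^sup>2 - yule_mean \<sigma> (t - x))) (at x)" if "x \<le> b" for x
  proof -
    have "((\<lambda>x. t - x) has_real_derivative -1) (at x)"
      by (auto intro!: derivative_eq_intros)
    from DERIV_chain2[OF DERIV_yule_mean this] show ?thesis
      using assms that by simp
  qed
  have "(\<integral>x. indicator {..b} x * (\<sigma> * (yule_mean \<sigma> (t - x))\<^sup>2) \<partial>exp_law) =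
      - (exp (- b) * yule_mean \<sigma> (t - b)) - (- (exp (- 0) * yule_mean \<sigma> (t - 0)))"
  proof (rule integral_exp_law_FTC[where H = "\<lambda>x. - (exp (- x) * yule_mean \<sigma> (t - x))"])
    fix x assume x: "0 \<le> x" "x \<le> b"
    show "((\<lambda>x. - (exp (- x) * yule_mean \<sigma> (t - x))) has_real_derivative
        exp (- x) * (\<sigma> * (yule_mean \<sigma> (t - x))\<^sup>2)) (at x)"
      by (rule derivative_eq_intros D[OF x(2)] refl)+ (simp add: algebra_simps)
    show "isCont (\<lambda>x. \<sigma> * (yule_mean \<sigma> (t - x))\<^sup>2) x"
      using DERIV_isCont[OF D[OF x(2)]] by (intro continuous_intros)
  qed (use assms in simp_all)
  then show ?thesis
    by simp
qed

lemma measurable_renewal [measurable]: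
  assumes [measurable]: "f \<in> borel_measurable borel"
  shows "renewal \<sigma> f t \<in> borel_measurable borel"
  unfolding renewal_def[abs_def] by measurable

lemma renewal_bounds:
  assumes "0 \<le> \<sigma>" "\<sigma> \<le> 1" and "\<And>s. 0 \<le> s \<Longrightarrow> 0 \<le> f s \<and> f s \<le> 1"
  shows "0 \<le> renewal \<sigma> f t x" "renewal \<sigma> f t x \<le> 1"
  using assms(1,2) assms(3)[of "t - x"]
  by (auto simp: renewal_def intro!: mult_le_one power_le_one)

lemma integrable_renewal:
  assumes "0 \<le> \<sigma>" "\<sigma> \<le> 1" and "\<And>s. 0 \<le> s \<Longrightarrow> 0 \<le> f s \<and> f s \<le> 1"
    and [measurable]: "f \<in> borel_measurable borel" "\<phi> \<in> borel_measurable borel"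
    and \<phi>: "\<And>x. \<bar>\<phi> x\<bar> \<le> 1"
  shows "integrable exp_law (\<lambda>x. \<phi> x * renewal \<sigma> f t x)"
proof -
  interpret prob_space exp_law by (rule prob_space_exp_law)
  show ?thesis
    by (rule integrable_const_bound[where B = 1])
      (use \<phi> renewal_bounds[OF assms(1-3)] in \<open>auto simp: abs_mult intro!: mult_le_one\<close>)
qed

text \<open>
  The fixed point property. The lifetimes beyond \<open>t\<close> contribute \<open>exp (- t)\<close>, which is
  exactly the boundary term of \<open>integral_yule_mean_square\<close> at \<open>b = t\<close>.
\<close>

lemma integral_renewal_yule_mean:
  assumes \<sigma>: "0 \<le> \<sigma>" "\<sigma> \<le> 1" and t: "0 \<le> t"
  shows "(\<integral>x. renewal \<sigma> (yule_mean \<sigma>) t x \<partial>exp_law) = yule_mean \<sigma> t"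
proof -
  interpret prob_space exp_law by (rule prob_space_exp_law)
  have yb: "0 \<le> yule_mean \<sigma> s \<and> yule_mean \<sigma> s \<le> 1" if "0 \<le> s" for s
    using yule_mean_bounds[OF \<sigma>(2) that] by simp
  \<comment> \<open>The integrand is split at \<open>t\<close> with \<open>1 - indicator {..t}\<close> for the tail, so that only integrals
    over bounded intervals have to be computed.\<close>
  have one: "(\<integral>x. indicator {..t} x * (1 :: real) \<partial>exp_law) = 1 - exp (- t)"
    using t by (subst integral_exp_law_FTC[where H = "\<lambda>x. - exp (- x)"])
      (auto intro!: derivative_eq_intros)
  have "renewal \<sigma> (yule_mean \<sigma>) t x = 1 - indicator {..t} x * 1 +
      indicator {..t} x * renewal \<sigma> (yule_mean \<sigma>) t x" for x
    by (auto simp: renewal_def split: split_indicator)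
  then have "(\<integral>x. renewal \<sigma> (yule_mean \<sigma>) t x \<partial>exp_law) =
      (\<integral>x. 1 - indicator {..t} x * 1 + indicator {..t} x * renewal \<sigma> (yule_mean \<sigma>) t x \<partial>exp_law)"
    by simp
  also have "\<dots> = (1 - (\<integral>x. indicator {..t} x * 1 \<partial>exp_law)) +
      (\<integral>x. indicator {..t} x * renewal \<sigma> (yule_mean \<sigma>) t x \<partial>exp_law)"
  proof -
    have "integrable exp_law (\<lambda>x. indicator {..t} x * renewal \<sigma> (yule_mean \<sigma>) t x)"
      by (rule integrable_renewal[OF \<sigma> yb]) (auto split: split_indicator)
    moreover have "integrable exp_law (\<lambda>x. indicator {..t} x * (1::real))"
      by (rule integrable_const_bound[where B = 1]) (auto split: split_indicator)
    ultimately show ?thesis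
      using prob_space by (subst Bochner_Integration.integral_add) simp_all
  qed
  also have "(\<integral>x. indicator {..t} x * renewal \<sigma> (yule_mean \<sigma>) t x \<partial>exp_law) =
      (\<integral>x. indicator {..t} x * (\<sigma> * (yule_mean \<sigma> (t - x))\<^sup>2) \<partial>exp_law)"
    by (rule Bochner_Integration.integral_cong) (auto simp: renewal_def split: split_indicator)
  finally show ?thesis
    unfolding one integral_yule_mean_square[OF \<sigma>(2) t order.refl] by simp
qed

text \<open>
  One Picard step. From \<open>f\<^sup>2 - g\<^sup>2 = (f - g) (f + g)\<close> with \<open>f + g \<le> 2\<close> the step multiplies an error
  by at most \<open>2\<close> and integrates it over \<open>{0..t}\<close>, so that the bound \<open>(2 s)^d / d!\<close> passes to the
  next term of the exponential series.
\<close>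

lemma renewal_contraction:
  assumes \<sigma>: "0 \<le> \<sigma>" "\<sigma> \<le> 1" and t: "0 \<le> t"
    and f: "\<And>s. 0 \<le> s \<Longrightarrow> 0 \<le> f s \<and> f s \<le> 1" and g: "\<And>s. 0 \<le> s \<Longrightarrow> 0 \<le> g s \<and> g s \<le> 1"
    and [measurable]: "f \<in> borel_measurable borel" "g \<in> borel_measurable borel"
      "\<phi> \<in> borel_measurable borel"
    and \<phi>: "\<And>x. \<bar>\<phi> x\<bar> \<le> 1"
    and close: "\<And>s. 0 \<le> s \<Longrightarrow> \<bar>f s - g s\<bar> \<le> (2 * s) ^ d / fact d"
  shows "\<bar>(\<integral>x. \<phi> x * renewal \<sigma> f t x \<partial>exp_law) - (\<integral>x. \<phi> x * renewal \<sigma> g t x \<partial>exp_law)\<bar> \<le>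
    (2 * t) ^ Suc d / fact (Suc d)"
proof -
  let ?\<Delta> = "\<lambda>x. \<phi> x * renewal \<sigma> f t x - \<phi> x * renewal \<sigma> g t x"
  have int: "integrable exp_law (\<lambda>x. \<phi> x * renewal \<sigma> f t x)" "integrable exp_law (\<lambda>x. \<phi> x * renewal \<sigma> g t x)"
    by (rule integrable_renewal[OF \<sigma>]; simp add: f g \<phi>)+
  have pointwise: "\<bar>?\<Delta> x\<bar> \<le> 2 * (2 * (t - x)) ^ d / fact d" if x: "x \<le> t" for x
  proof -
    have "\<bar>?\<Delta> x\<bar> = \<bar>\<phi> x\<bar> * (\<sigma> * (\<bar>f (t - x) - g (t - x)\<bar> * \<bar>f (t - x) + g (t - x)\<bar>))"
    proof -
      have "?\<Delta> x = \<phi> x * (\<sigma> * ((f (t - x) - g (t - x)) * (f (t - x) + g (t - x))))"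
        using x by (simp add: renewal_def algebra_simps power2_eq_square)
      then show ?thesis
        using \<sigma> by (simp add: abs_mult)
    qed
    also have "\<dots> \<le> 1 * (1 * (((2 * (t - x)) ^ d / fact d) * 2))"
      using x \<sigma> \<phi> f[of "t - x"] g[of "t - x"] close[of "t - x"]
      by (intro mult_mono mult_nonneg_nonneg) auto
    finally show ?thesis
      by (simp add: mult.commute)
  qed
  have "\<bar>(\<integral>x. \<phi> x * renewal \<sigma> f t x \<partial>exp_law) - (\<integral>x. \<phi> x * renewal \<sigma> g t x \<partial>exp_law)\<bar> =
      \<bar>\<integral>x. ?\<Delta> x \<partial>exp_law\<bar>"
    using int by simp
  also have "\<dots> \<le> (\<integral>x. \<bar>?\<Delta> x\<bar> \<partial>exp_law)"
    by (rule integral_abs_bound)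
  also have "\<dots> = (\<integral>x. exponential_density 1 x *\<^sub>R \<bar>?\<Delta> x\<bar> \<partial>lborel)"
    by (rule integral_density) (auto simp: exponential_density_def)
  also have "\<dots> \<le> (\<integral>x. 2 * (2 * (t - x)) ^ d / fact d * indicator {0..t} x \<partial>lborel)"
  proof (rule integral_mono')
    show "integrable lborel (\<lambda>x. 2 * (2 * (t - x)) ^ d / fact d * indicator {0..t} x :: real)"
      using borel_integrable_atLeastAtMost'[of 0 t "\<lambda>x. 2 * (2 * (t - x)) ^ d / fact d :: real"]
      by (simp add: set_integrable_def mult.commute continuous_intros)
    fix x :: real
    show "exponential_density 1 x *\<^sub>R \<bar>?\<Delta> x\<bar> \<le> 2 * (2 * (t - x)) ^ d / fact d * indicator {0..t} x"
    proof (cases "0 \<le> x \<and> x \<le> t")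
      case True
      then have "exp (- x) * \<bar>?\<Delta> x\<bar> \<le> 1 * (2 * (2 * (t - x)) ^ d / fact d)"
        using pointwise[of x] by (intro mult_mono) auto
      then show ?thesis
        using True by (simp add: exponential_density_def)
    qed (auto simp: exponential_density_def renewal_def)
    show "0 \<le> 2 * (2 * (t - x)) ^ d / fact d * (indicator {0..t} x :: real)"
      by (auto split: split_indicator)
  qed
  also have "\<dots> = - ((2 * (t - t)) ^ Suc d / fact (Suc d)) - (- ((2 * (t - 0)) ^ Suc d / fact (Suc d)))"
  proof (rule integral_FTC_Icc_real)
    fix x :: real
    show "((\<lambda>x. - ((2 * (t - x)) ^ Suc d / fact (Suc d))) has_real_derivative
        2 * (2 * (t - x)) ^ d / fact d) (at x)"
      by (rule derivative_eq_intros refl | simp)+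
  qed (use t in \<open>auto intro!: continuous_intros\<close>)
  finally show ?thesis
    by simp
qed

text \<open>
  The induction starts from the bound \<open>1\<close>, as both functions have values in \<open>[0, 1]\<close>.
  For \<open>\<sigma> = 1\<close>, where \<open>yule_mean\<close> is constantly \<open>1\<close>, this says that the tree does not explode: the
  probability that generation \<open>d\<close> is reached by time \<open>t\<close> is at most \<open>(2 t)^d / d!\<close>.
\<close>

lemma mean_weight_near_yule_mean:
  assumes \<sigma>: "0 \<le> \<sigma>" "\<sigma> \<le> 1" and t: "0 \<le> t"
  shows "\<bar>mean_weight \<sigma> d t - yule_mean \<sigma> t\<bar> \<le> (2 * t) ^ d / fact d"
  using t
proof (induction d arbitrary: t)
  case 0
  then show ?case
    using yule_mean_bounds[OF \<sigma>(2) 0] by (simp add: mean_weight_def)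
next
  case (Suc d)
  have "mean_weight \<sigma> (Suc d) t = (\<integral>x. 1 * renewal \<sigma> (mean_weight \<sigma> d) t x \<partial>exp_law)"
    using integral_confined_weight_Suc[OF \<sigma>, of "\<lambda>_. 1" d t] by (simp add: mean_weight_def[of _ "Suc d"])
  moreover have "yule_mean \<sigma> t = (\<integral>x. 1 * renewal \<sigma> (yule_mean \<sigma>) t x \<partial>exp_law)"
    using integral_renewal_yule_mean[OF \<sigma> Suc.prems] by simp
  ultimately show ?case
    using renewal_contraction[OF \<sigma> Suc.prems, of "mean_weight \<sigma> d" "yule_mean \<sigma>" "\<lambda>_. 1" d]
      mean_weight_bounds[OF \<sigma>] yule_mean_bounds[OF \<sigma>(2)] Suc.IH by (simp add: less_imp_le)
qed

section \<open>Counting particles along the tree\<close>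

text \<open>
  The set of living particles as a function of a fixed family of lifetimes; this is the predicate
  \<open>alive\<close> on the canonical space, where the lifetimes are the coordinates.
\<close>

abbreviation alive_labels :: "(bool list \<Rightarrow> real) \<Rightarrow> real \<Rightarrow> bool list set" where
  "alive_labels l t \<equiv> {u. alive (\<lambda>u l. l u) u t l}"

lemma birth_time_Cons:
  "birth_time (\<lambda>u l. l u) (b # u) l = l [] + birth_time (\<lambda>u l. l u) u (\<lambda>u. l (b # u))"
  by (simp add: birth_time_def sum.lessThan_Suc_shift del: sum.lessThan_Suc)

lemma birth_time_nonneg:
  assumes "\<And>u. 0 < l u"
  shows "0 \<le> birth_time (\<lambda>u l. l u) u l"
  unfolding birth_time_def using assms by (intro sum_nonneg) (auto intro: less_imp_le)

lemma alive_Cons: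
  "alive (\<lambda>u l. l u) (b # u) t l \<longleftrightarrow> alive (\<lambda>u l. l u) u (t - l []) (\<lambda>u. l (b # u))"
  by (auto simp: alive_def birth_time_Cons)

lemma alive_labels_before:
  assumes "\<And>u. 0 < l u" "0 \<le> t" "t < l []"
  shows "alive_labels l t = {[]}"
proof -
  have "alive (\<lambda>u l. l u) u t l \<longleftrightarrow> u = []" for u
  proof (cases u)
    case Nil
    then show ?thesis
      using assms by (simp add: alive_def birth_time_def)
  next
    case (Cons b v)
    have "t < birth_time (\<lambda>u l. l u) u l"
      using birth_time_nonneg[of "\<lambda>u. l (b # u)" v] assms by (simp add: Cons birth_time_Cons)
    then show ?thesis
      by (simp add: Cons alive_def)
  qed
  then show ?thesis
    by simp
qed

lemma alive_labels_after:
  assumes "l [] \<le> t"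
  shows "alive_labels l t =
    Cons False ` alive_labels (\<lambda>u. l (False # u)) (t - l []) \<union>
    Cons True ` alive_labels (\<lambda>u. l (True # u)) (t - l [])"
proof (intro set_eqI)
  fix u show "u \<in> alive_labels l t \<longleftrightarrow> u \<in> Cons False ` alive_labels (\<lambda>u. l (False # u)) (t - l []) \<union>
    Cons True ` alive_labels (\<lambda>u. l (True # u)) (t - l [])"
  proof (cases u)
    case Nil
    then show ?thesis
      using assms by (auto simp: alive_def birth_time_def)
  next
    case (Cons b v)
    then show ?thesis
      by (cases b) (auto simp: alive_Cons)
  qed
qed

lemma card_alive_labels_after:
  assumes "l [] \<le> t" "finite (alive_labels (\<lambda>u. l (False # u)) (t - l []))"
    "finite (alive_labels (\<lambda>u. l (True # u)) (t - l []))"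
  shows "card (alive_labels l t) =
    card (alive_labels (\<lambda>u. l (False # u)) (t - l [])) +
    card (alive_labels (\<lambda>u. l (True # u)) (t - l []))"
  unfolding alive_labels_after[of l t, OF assms(1)]
  by (subst card_Un_disjoint) (use assms in \<open>auto simp: card_image\<close>)

text \<open>
  The recursion adds up the particle counts of the two subtrees. This is legitimate for the
  weights that are not \<open>0\<close>, since their trees are finite, and the truncated subtraction in
  \<open>n - 1\<close> is exact since each subtree contains a living particle.
\<close>

lemma confined_weight_cases:
  assumes "\<And>u. 0 < l u" "0 \<le> t"
  shows "(confined_weight 1 d l t = 0 \<and> confined_weight \<sigma> d l t = 0) \<or>
    (confined_weight 1 d l t = 1 \<and> finite (alive_labels l t) \<and> 0 < card (alive_labels l t) \<and>
      confined_weight \<sigma> d l t = \<sigma> ^ (card (alive_labels l t) - 1))"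
  using assms
proof (induction d arbitrary: l t)
  case (Suc d)
  show ?case
  proof (cases "t < l []")
    case True
    then show ?thesis
      using alive_labels_before[of l t] Suc.prems by simp
  next
    case False
    let ?f = "\<lambda>u. l (False # u)" and ?g = "\<lambda>u. l (True # u)" and ?s = "t - l []"
    let ?m = "card (alive_labels ?f ?s)" and ?n = "card (alive_labels ?g ?s)"
    have IH: "(confined_weight 1 d k ?s = 0 \<and> confined_weight \<sigma> d k ?s = 0) \<or>
        (confined_weight 1 d k ?s = 1 \<and> finite (alive_labels k ?s) \<and> 0 < card (alive_labels k ?s) \<and>
          confined_weight \<sigma> d k ?s = \<sigma> ^ (card (alive_labels k ?s) - 1))"
      if "k = ?f \<or> k = ?g" for k
      using Suc.IH[of k ?s] Suc.prems False that by auto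
    show ?thesis
    proof (cases "confined_weight 1 d ?f ?s = 0 \<or> confined_weight 1 d ?g ?s = 0")
      case True
      then show ?thesis
        using IH[of ?f] IH[of ?g] False by auto
    next
      case not0: False
      note F = IH[of ?f, simplified] and G = IH[of ?g, simplified]
      have fin: "finite (alive_labels ?f ?s)" "finite (alive_labels ?g ?s)"
        using F G not0 by auto
      have card: "card (alive_labels l t) = ?m + ?n"
        using card_alive_labels_after[OF _ fin] False by simp
      have pos: "0 < ?m" "0 < ?n"
        using F G not0 by auto
      have "confined_weight \<sigma> (Suc d) l t = \<sigma> * \<sigma> ^ (?m - 1) * \<sigma> ^ (?n - 1)"
        using F G not0 False by auto
      also have "\<dots> = \<sigma> ^ Suc ((?m - 1) + (?n - 1))"
        by (simp add: power_add)
      also have "Suc ((?m - 1) + (?n - 1)) = card (alive_labels l t) - 1"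
        unfolding card using pos by simp
      finally have w: "confined_weight \<sigma> (Suc d) l t = \<sigma> ^ (card (alive_labels l t) - 1)" .
      have "confined_weight 1 (Suc d) l t = 1"
        using F G not0 False by auto
      moreover have "0 < card (alive_labels l t)"
        unfolding card using pos by simp
      moreover from this have "finite (alive_labels l t)"
        by (simp add: card_gt_0_iff)
      ultimately show ?thesis
        using w by blast
    qed
  qed
qed simp

text \<open>
  Outside the event of confinement the right-hand side is \<open>1\<close>, and the true weight lies in \<open>[0, 1]\<close>
  even if infinitely many particles are alive. Thus the error is controlled by confined
  weights with \<open>\<sigma> = 1\<close>.
\<close>

lemma confined_weight_error:
  assumes \<sigma>: "0 \<le> \<sigma>" "\<sigma> \<le> 1" and l: "\<And>u. 0 < l u" and t: "0 \<le> t"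
  shows "\<bar>\<sigma> ^ (card (alive_labels l t) - 1) - confined_weight \<sigma> d l t\<bar> \<le> 1 - confined_weight 1 d l t"
  using confined_weight_cases[of l t d \<sigma>, OF l t] \<sigma> by (auto simp: power_le_one)

lemma num_particles_eq: "num_particles L B t w = card (alive_labels (\<lambda>u. L u w) t)"
proof -
  have "particles L B t w = (\<lambda>u. (u, position L B u t w)) ` alive_labels (\<lambda>u. L u w) t"
    by (auto simp: particles_def alive_def birth_time_def)
  then show ?thesis
    by (simp add: num_particles_def card_image inj_on_def)
qed

section \<open>The law of the particle count and the first branching time\<close>

context binary_BBM
begin

lemma measurable_lifetime [measurable]: "L u \<in> borel_measurable M"
  using distributed_measurable[OF lifetime_exponential] by simp

text \<open>
  There is one particle before time \<open>L [] w\<close>. At that time the two children are just born, and they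
  are alive because their lifetimes are positive, so the infimum is attained there.
\<close>

lemma first_branching_time_eq:
  assumes w: "w \<in> space M"
  shows "first_branching_time L B w = L [] w"
  unfolding first_branching_time_def num_particles_eq
proof (rule cInf_eq_minimum)
  let ?l = "\<lambda>u. L u w"
  have pos: "0 < L u w" for u
    using lifetime_pos[OF w] .
  have "alive_labels (\<lambda>u. L (b # u) w) (L [] w - L [] w) = {[]}" for b
    using pos by (intro alive_labels_before) auto
  then have "card (alive_labels ?l (L [] w)) = 2"
    using card_alive_labels_after[of ?l "L [] w"] by simp
  then show "L [] w \<in> {s. 0 < s \<and> card (alive_labels ?l s) = 2}"
    using pos by simp
  fix s assume s: "s \<in> {s. 0 < s \<and> card (alive_labels ?l s) = 2}"
  show "L [] w \<le> s"
  proof (rule ccontr)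
    assume "\<not> L [] w \<le> s"
    with s have "alive_labels ?l s = {[]}"
      using pos by (intro alive_labels_before) auto
    with s show False
      by simp
  qed
qed

text \<open>
  The labels are encoded as natural numbers, for which the cardinality of a random set is known
  to be measurable; each label is alive on a measurable event.
\<close>

lemma measurable_num_particles:
  "num_particles L B t \<in> M \<rightarrow>\<^sub>M count_space UNIV"
proof -
  let ?S = "\<lambda>w. to_nat ` alive_labels (\<lambda>u. L u w) t"
  have alive: "{w \<in> space M. alive (\<lambda>u l. l u) u t (\<lambda>u. L u w)} \<in> sets M" for u
    unfolding alive_def birth_time_def by measurable
  have "(\<lambda>w. card (?S w)) \<in> M \<rightarrow>\<^sub>M count_space UNIV"
  proof (rule measurable_card)
    fix i
    have "{w \<in> space M. i \<in> ?S w} =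
        (\<Union>u\<in>{u. to_nat u = i}. {w \<in> space M. alive (\<lambda>u l. l u) u t (\<lambda>u. L u w)})"
      by auto
    also have "\<dots> \<in> sets M"
      using alive by (intro sets.countable_UN'') auto
    finally show "{w \<in> space M. i \<in> ?S w} \<in> sets M" .
  qed
  also have "(\<lambda>w. card (?S w)) = num_particles L B t"
    by (auto simp: num_particles_eq card_image)
  finally show ?thesis .
qed

lemma distr_lifetimes: "distr M tree_law (\<lambda>w u. L u w) = tree_law"
proof -
  have "indep_vars (\<lambda>_. borel) L UNIV"
    unfolding indep_vars_def2
  proof (intro conjI ballI)
    let ?F = "\<lambda>u. {L u -` A \<inter> space M |A. A \<in> sets borel}"
    show "indep_sets ?F UNIV"
    proof (rule indep_setsI)
      show "?F u \<subseteq> events" for u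
        by (auto intro: measurable_sets[OF measurable_lifetime])
      fix A and J :: "bool list set"
      assume J: "J \<noteq> {}" "finite J" and A: "\<forall>j\<in>J. A j \<in> ?F j"
      \<comment> \<open>Lifetimes are the left summand of the jointly independent family; the value \<open>{}\<close> on the right
        summand is never used, as only indices in \<open>Inl ` J\<close> occur.\<close>
      let ?J = "Inl ` J :: (bool list + bool list) set"
      have "prob (\<Inter>j\<in>?J. case_sum A (\<lambda>_. {}) j) = (\<Prod>j\<in>?J. prob (case_sum A (\<lambda>_. {}) j))"
        by (rule indep_setsD[OF independent])
          (use J A in \<open>auto simp: sets_vimage_algebra intro!: sigma_sets.Basic\<close>)
      then show "prob (\<Inter>j\<in>J. A j) = (\<Prod>j\<in>J. prob (A j))"
        by (simp add: prod.reindex)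
    qed
  qed simp
  then have "distr M (PiM UNIV (\<lambda>_. borel)) (\<lambda>w. \<lambda>u\<in>UNIV. L u w) = PiM UNIV (\<lambda>u. distr M borel (L u))"
    by (subst (asm) indep_vars_iff_distr_eq_PiM) auto
  moreover have "distr M borel (L u) = exp_law" for u
    using distributed_distr_eq_density[OF lifetime_exponential, of u]
    by (simp cong: distr_cong)
  moreover have "distr M tree_law (\<lambda>w u. L u w) = distr M (PiM UNIV (\<lambda>_. borel)) (\<lambda>w u. L u w)"
    by (rule distr_cong) (auto intro!: sets_PiM_cong)
  ultimately show ?thesis
    by (simp add: restrict_UNIV)
qed

lemma integral_lifetimes:
  assumes "F \<in> borel_measurable tree_law"
  shows "(\<integral>w. F (\<lambda>u. L u w) \<partial>M) = (\<integral>l. (F l :: real) \<partial>tree_law)"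
    and "integrable tree_law F \<Longrightarrow> integrable M (\<lambda>w. F (\<lambda>u. L u w))"
proof -
  have m: "(\<lambda>w u. L u w) \<in> M \<rightarrow>\<^sub>M tree_law"
    by (rule measurable_PiM_single') (auto simp: space_PiM)
  show "(\<integral>w. F (\<lambda>u. L u w) \<partial>M) = (\<integral>l. F l \<partial>tree_law)"
    using integral_distr[OF m assms] by (simp add: distr_lifetimes)
  show "integrable tree_law F \<Longrightarrow> integrable M (\<lambda>w. F (\<lambda>u. L u w))"
    using integrable_distr[OF m, of F] by (simp add: distr_lifetimes)
qed

text \<open>
  Three quantities are compared: the expectation on the left, the same with
  \<open>confined_weight \<sigma> (Suc d)\<close> in place of the weight, and the integral on the right. The first two
  differ by at most the probability that the tree is not confined to \<open>Suc d\<close> generations, the last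
  two by the error of one Picard step from \<open>mean_weight \<sigma> d\<close>. Both are at most
  \<open>(2 t)^(d + 1) / (d + 1)!\<close>.
\<close>

lemma expectation_lifetime_weight:
  assumes \<sigma>: "0 \<le> \<sigma>" "\<sigma> \<le> 1" and t: "0 \<le> t"
    and [measurable]: "\<phi> \<in> borel_measurable borel" and \<phi>: "\<And>x. \<bar>\<phi> x\<bar> \<le> 1"
  shows "(\<integral>w. \<phi> (L [] w) * \<sigma> ^ (num_particles L B t w - 1) \<partial>M) =
    (\<integral>x. \<phi> x * renewal \<sigma> (yule_mean \<sigma>) t x \<partial>exp_law)" (is "?I = ?J")
proof -
  have root [measurable]: "(\<lambda>l. l []) \<in> tree_law \<rightarrow>\<^sub>M borel"
    using measurable_component_singleton[of "[]" UNIV "\<lambda>_. exp_law"] by simp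
  interpret T: prob_space tree_law by (rule prob_space_tree_law)
  have bound: "\<bar>?I - ?J\<bar> \<le> 2 * ((2 * t) ^ Suc d / fact (Suc d))" for d
  proof -
    define X where "X w = \<phi> (L [] w) * \<sigma> ^ (num_particles L B t w - 1)" for w
    define Y where "Y w = \<phi> (L [] w) * confined_weight \<sigma> (Suc d) (\<lambda>u. L u w) t" for w
    define Z where "Z w = 1 - confined_weight 1 (Suc d) (\<lambda>u. L u w) t" for w
    have [measurable]: "(\<lambda>w. \<sigma> ^ (num_particles L B t w - 1)) \<in> borel_measurable M"
      by (rule measurable_compose[OF measurable_num_particles]) simp
    have [measurable]: "X \<in> borel_measurable M"
      unfolding X_def[abs_def] by measurable
    have X: "integrable M X"
      by (rule integrable_const_bound[where B = 1])
        (use \<sigma> \<phi> in \<open>auto simp: X_def abs_mult power_le_one intro!: mult_le_one\<close>)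
    have "integrable tree_law (\<lambda>l. \<phi> (l []) * confined_weight \<sigma> (Suc d) l t)"
      by (rule T.integrable_const_bound[where B = 1])
        (use \<phi> confined_weight_bounds[OF \<sigma>, of "Suc d" _ t] in
          \<open>auto simp: abs_mult simp del: confined_weight.simps intro!: mult_le_one\<close>)
    note W = borel_measurable_integrable[OF this] this
    have Y: "integrable M Y" "integral\<^sup>L M Y = (\<integral>x. \<phi> x * renewal \<sigma> (mean_weight \<sigma> d) t x \<partial>exp_law)"
      using integral_lifetimes(1)[OF W(1)] integral_lifetimes(2)[OF W]
        integral_confined_weight_Suc[OF \<sigma>, of \<phi> d t] \<phi>
      by (simp_all add: Y_def[abs_def] del: confined_weight.simps)
    have Z: "integrable M Z" "integral\<^sup>L M Z = 1 - mean_weight 1 (Suc d) t"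
      using integral_lifetimes[of "\<lambda>l. confined_weight 1 (Suc d) l t"] integrable_confined_weight[of 1 "Suc d" t]
      by (simp_all add: Z_def[abs_def] prob_space mean_weight_def del: confined_weight.simps)
    have "\<bar>integral\<^sup>L M X - integral\<^sup>L M Y\<bar> = \<bar>\<integral>w. X w - Y w \<partial>M\<bar>"
      using X Y by simp
    also have "\<dots> \<le> (\<integral>w. \<bar>X w - Y w\<bar> \<partial>M)"
      by (rule integral_abs_bound)
    also have "\<dots> \<le> integral\<^sup>L M Z"
    proof (rule integral_mono)
      show "integrable M (\<lambda>w. \<bar>X w - Y w\<bar>)"
        using X Y by simp
      show "integrable M Z"
        by (rule Z)
      fix w assume w: "w \<in> space M"
      have "\<bar>X w - Y w\<bar> = \<bar>\<phi> (L [] w)\<bar> * \<bar>\<sigma> ^ (card (alive_labels (\<lambda>u. L u w) t) - 1) -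
          confined_weight \<sigma> (Suc d) (\<lambda>u. L u w) t\<bar>"
        unfolding X_def Y_def num_particles_eq by (simp add: abs_mult[symmetric] right_diff_distrib)
      also have "\<dots> \<le> 1 * Z w"
        unfolding Z_def using \<phi> lifetime_pos[OF w] t \<sigma> by (intro mult_mono confined_weight_error) auto
      finally show "\<bar>X w - Y w\<bar> \<le> Z w"
        by simp
    qed
    also have "\<dots> \<le> (2 * t) ^ Suc d / fact (Suc d)"
      using mean_weight_near_yule_mean[of 1 t "Suc d"] t unfolding Z by (simp add: yule_mean_def)
    finally have "\<bar>integral\<^sup>L M X - integral\<^sup>L M Y\<bar> \<le> (2 * t) ^ Suc d / fact (Suc d)" .
    moreover have "\<bar>integral\<^sup>L M Y - ?J\<bar> \<le> (2 * t) ^ Suc d / fact (Suc d)"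
      unfolding Y(2)
      by (rule renewal_contraction[OF \<sigma> t])
        (use mean_weight_bounds[OF \<sigma>] yule_mean_bounds[OF \<sigma>(2)] mean_weight_near_yule_mean[OF \<sigma>] \<phi>
          in \<open>auto intro: less_imp_le\<close>)
    ultimately show ?thesis
      unfolding X_def by linarith
  qed
  have "(\<lambda>d. 2 * ((2 * t) ^ Suc d / fact (Suc d))) \<longlonglongrightarrow> 2 * 0"
    using LIMSEQ_Suc[OF summable_LIMSEQ_zero[OF summable_exp[of "2 * t"]]]
    by (intro tendsto_intros) (simp add: field_simps del: fact_Suc power_Suc)
  then have "\<bar>?I - ?J\<bar> \<le> 2 * 0"
    by (rule LIMSEQ_le_const) (use bound in auto)
  then show ?thesis
    by simp
qed

end

lemma repulsion_sigma_bounds: "0 \<le> repulsion_sigma lam \<epsilon>" "repulsion_sigma lam \<epsilon> \<le> 1"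
  using cosh_real_ge_1[of "\<epsilon> * sqrt (2 * lam)"] by (simp_all add: repulsion_sigma_def sech_def)

text \<open>
  The tilted probability is \<open>1 - exp (- (t - r)) v(r) / v(t)\<close>, and the rest is algebra.
\<close>

theorem theorem2p3:
  fixes M :: "'w measure"
    and L :: "bool list \<Rightarrow> 'w \<Rightarrow> real"
    and B :: "bool list \<Rightarrow> real \<Rightarrow> 'w \<Rightarrow> real"
    and lam \<epsilon> \<sigma> r t :: real
  assumes "binary_BBM M L B"
    and "0 \<le> lam" and "0 < \<epsilon>" and "\<sigma> = repulsion_sigma lam \<epsilon>"
    and "0 \<le> r" and "r \<le> t"
  shows "tilted_law M L B lam \<epsilon> t {w \<in> space M. first_branching_time L B w \<le> t - r} =
    \<sigma> * ((exp (- r) - exp (- t)) / (1 - \<sigma> * (1 - exp (- r))))"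
proof -
  interpret binary_BBM M L B by fact
  have \<sigma>: "0 \<le> \<sigma>" "\<sigma> \<le> 1"
    using repulsion_sigma_bounds assms(4) by auto
  have t: "0 \<le> t"
    using assms by simp
  have "v_fun M L B \<sigma> t = (\<integral>x. renewal \<sigma> (yule_mean \<sigma>) t x \<partial>exp_law)"
    using expectation_lifetime_weight[OF \<sigma> t, of "\<lambda>_. 1"] by (simp add: v_fun_def)
  then have v: "v_fun M L B \<sigma> t = yule_mean \<sigma> t"
    by (simp add: integral_renewal_yule_mean[OF \<sigma> t])
  have "(\<integral>w. indicator {w \<in> space M. first_branching_time L B w \<le> t - r} w *
        \<sigma> ^ (num_particles L B t w - 1) \<partial>M) =
      (\<integral>w. indicator {..t - r} (L [] w) * \<sigma> ^ (num_particles L B t w - 1) \<partial>M)"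
    by (rule Bochner_Integration.integral_cong) (auto simp: first_branching_time_eq split: split_indicator)
  also have "\<dots> = (\<integral>x. indicator {..t - r} x * renewal \<sigma> (yule_mean \<sigma>) t x \<partial>exp_law)"
    by (rule expectation_lifetime_weight[OF \<sigma> t]) (auto split: split_indicator)
  also have "\<dots> = (\<integral>x. indicator {..t - r} x * (\<sigma> * (yule_mean \<sigma> (t - x))\<^sup>2) \<partial>exp_law)"
    using assms(5) by (intro Bochner_Integration.integral_cong)
      (auto simp: renewal_def split: split_indicator)
  also have "\<dots> = yule_mean \<sigma> t - exp (r - t) * yule_mean \<sigma> r"
    using integral_yule_mean_square[OF \<sigma>(2), of "t - r" t] assms(5,6) by simp
  finally have "tilted_law M L B lam \<epsilon> t {w \<in> space M. first_branching_time L B w \<le> t - r} =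
      (yule_mean \<sigma> t - exp (r - t) * yule_mean \<sigma> r) / yule_mean \<sigma> t"
    unfolding tilted_law_def assms(4)[symmetric] v by simp
  also have "\<dots> = \<sigma> * ((exp (- r) - exp (- t)) / (1 - \<sigma> * (1 - exp (- r))))"
  proof -
    define a b where "a = 1 - \<sigma> * (1 - exp (- t))" and "b = 1 - \<sigma> * (1 - exp (- r))"
    have ab: "0 < a" "0 < b"
      unfolding a_def b_def using yule_mean_denominator_bounds \<sigma> t assms(5) by auto
    have "exp (r - t) * yule_mean \<sigma> r = exp (- t) / b"
      by (simp add: yule_mean_def b_def mult_exp_exp)
    then have "(yule_mean \<sigma> t - exp (r - t) * yule_mean \<sigma> r) / yule_mean \<sigma> t =
        (exp (- t) / a - exp (- t) / b) / (exp (- t) / a)"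
      by (simp add: yule_mean_def a_def)
    also have "\<dots> = (b - a) / b"
      using ab by (simp add: field_simps)
    also have "b - a = \<sigma> * (exp (- r) - exp (- t))"
      by (simp add: a_def b_def algebra_simps)
    finally show ?thesis
      by (simp add: b_def)
  qed
  finally show ?thesis .
qed

end
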